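(* Let $S$ be the monoid generated by the transformations $f_0,f_1$ defined by the automaton $\mathcal{I}_2$, and let $\delta_S$, $\gamma_{\mathcal{I}_2}$, $\gamma_S$ be the word growth function of $S$, the growth function of the automaton $\mathcal{I}_2$, and the growth function of $S$ (as in the context). Then, as formal power series: (1) the word growth series $\Delta_S(X)=\sum_{n\ge0}\delta_S(n)X^n$ is $$\Delta_S(X)=(1+X)\left(1+\frac{X}{1-X}\prod_{n\ge0}\left(1+X^{2n+1}\right)\right);$$ (2) the growth series $\Gamma_{\mathcal{I}_2}(X)=\sum_{n\ge0}\gamma_{\mathcal{I}_2}(n)X^n$ of the automaton is $$\Gamma_{\mathcal{I}_2}(X)=\frac{1}{1-X}\left(1+\frac{X}{1-X}\prod_{n\ge0}\left(1+X^{2n+1}\right)\right);$$ (3) the growth series $\Gamma_S(X)=\sum_{n\ge0}\gamma_S(n)X^n$ of the monoid is $$\Gamma_S(X)=\frac{1+X}{1-X}\left(1+\frac{X}{1-X}\prod_{n\ge0}\left(1+X^{2n+1}\right)\right).$$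
   Context: The automaton $\mathcal{I}_2$ is the $2$-state Mealy automaton over the alphabet $\{x_0,x_1\}$ whose two states define the following transformations $f_0,f_1$ of the set of (right-)infinite words $\{x_0,x_1\}^{\omega}$, given recursively, for every infinite word $u$, by $$f_0(x_0u)=x_1f_0(u),\quad f_0(x_1u)=x_0f_0(u),\quad f_1(x_0u)=x_1f_1(u),\quad f_1(x_1u)=x_1f_0(u).$$ Products are compositions with the right factor applied first: $(fg)(u)=f(g(u))$. $S$ is the semigroup generated by $f_0,f_1$ under composition; since $f_0^2=1$, it is a monoid. The length of an element $s\in S$, $s\neq 1$, is the least $\ell>0$ such that $s$ is a product of $\ell$ elements of $\{f_0,f_1\}$; the length of $1$ is $0$. Then $\delta_S(n)$ is the number of elements of $S$ of length exactly $n$, and $\gamma_S(n)$ is the number of elements of $S$ of length at most $n$. The growth function $\gamma_{\mathcal{I}_2}(n)$, $n\ge1$, is the number of states of the minimal Mealy automaton equivalent to the $n$-th power of $\mathcal{I}_2$; equivalently, it is the number of distinct transformations of the form $f_{i_1}f_{i_2}\cdots f_{i_n}$ with $i_1,\dots,i_n\in\{0,1\}$. By convention $\gamma_{\mathcal{I}_2}(0)=1$ (the empty product). *)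

theory Defs
  imports "HOL-Analysis.Analysis" "HOL-Computational_Algebra.Formal_Power_Series" "HOL-Library.Stream"
begin

section \<open>Mealy automata\<close>

text \<open>The alphabet is the type \<open>'a\<close>; infinite words are streams over it.\<close>

record ('q, 'a) mealy =
  states :: "'q set"
  trans :: "'q \<Rightarrow> 'a \<Rightarrow> 'q"
  out :: "'q \<Rightarrow> 'a \<Rightarrow> 'a"

definition mealy_automaton :: "('q, 'a) mealy \<Rightarrow> bool" where
  "mealy_automaton A \<longleftrightarrow>
     finite (states A) \<and> states A \<noteq> {} \<and> (\<forall>q\<in>states A. \<forall>x. trans A q x \<in> states A)"

primcorec mealy_map :: "('q, 'a) mealy \<Rightarrow> 'q \<Rightarrow> 'a stream \<Rightarrow> 'a stream" where
  "mealy_map A q u = out A q (shd u) ## mealy_map A (trans A q (shd u)) (stl u)"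

lemma mealy_map_Cons: "mealy_map A q (x ## u) = out A q x ## mealy_map A (trans A q x) u"
  by (rule stream.expand) simp

definition mealy_maps :: "('q, 'a) mealy \<Rightarrow> ('a stream \<Rightarrow> 'a stream) set" where
  "mealy_maps A = mealy_map A ` states A"

definition mealy_equiv :: "('q, 'a) mealy \<Rightarrow> ('r, 'a) mealy \<Rightarrow> bool" where
  "mealy_equiv A B \<longleftrightarrow> mealy_maps A = mealy_maps B"

text \<open>
  The \<open>n\<close>-th power of \<open>A\<close>: a state is a list of \<open>n\<close> states of \<open>A\<close>, the letter being processed by
  the rightmost entry first (see \<open>mealy_map_power\<close> below). For \<open>n = 0\<close> this is the one-state
  automaton of the identity.
\<close>

fun out_list :: "('q, 'a) mealy \<Rightarrow> 'q list \<Rightarrow> 'a \<Rightarrow> 'a" where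
  "out_list A [] x = x"
| "out_list A (q # qs) x = out A q (out_list A qs x)"

fun trans_list :: "('q, 'a) mealy \<Rightarrow> 'q list \<Rightarrow> 'a \<Rightarrow> 'q list" where
  "trans_list A [] x = []"
| "trans_list A (q # qs) x = trans A q (out_list A qs x) # trans_list A qs x"

definition mealy_power :: "('q, 'a) mealy \<Rightarrow> nat \<Rightarrow> ('q list, 'a) mealy" where
  "mealy_power A n =
     \<lparr>states = {qs. set qs \<subseteq> states A \<and> length qs = n}, trans = trans_list A, out = out_list A\<rparr>"

text \<open>
  The number of states of a minimal automaton equivalent to \<open>A\<close>. Every finite automaton is
  isomorphic to one with states in \<open>nat\<close>, so ranging over those loses nothing.
\<close>

definition minimal_size :: "('q, 'a) mealy \<Rightarrow> nat" where
  "minimal_size A =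
     (LEAST k. \<exists>B :: (nat, 'a) mealy. mealy_automaton B \<and> mealy_equiv B A \<and> card (states B) = k)"

definition automaton_growth :: "('q, 'a) mealy \<Rightarrow> nat \<Rightarrow> nat" where
  "automaton_growth A n = minimal_size (mealy_power A n)"


section \<open>Growth of transformation semigroups\<close>

text \<open>Products are compositions, the right factor being applied first.\<close>

definition comp_list :: "('b \<Rightarrow> 'b) list \<Rightarrow> 'b \<Rightarrow> 'b" where
  "comp_list fs = foldr (\<circ>) fs id"

inductive_set semigroup_generated :: "('b \<Rightarrow> 'b) set \<Rightarrow> ('b \<Rightarrow> 'b) set"
  for G :: "('b \<Rightarrow> 'b) set" where
  gen: "f \<in> G \<Longrightarrow> f \<in> semigroup_generated G"
| comp: "f \<in> semigroup_generated G \<Longrightarrow> g \<in> semigroup_generated G \<Longrightarrow> f \<circ> g \<in> semigroup_generated G"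

definition word_length :: "('b \<Rightarrow> 'b) set \<Rightarrow> ('b \<Rightarrow> 'b) \<Rightarrow> nat" where
  "word_length G s =
     (if s = id then 0
      else (LEAST l. l > 0 \<and> (\<exists>fs. length fs = l \<and> set fs \<subseteq> G \<and> s = comp_list fs)))"

definition word_growth :: "('b \<Rightarrow> 'b) set \<Rightarrow> nat \<Rightarrow> nat" where
  "word_growth G n = card {s \<in> semigroup_generated G. word_length G s = n}"

definition semigroup_growth :: "('b \<Rightarrow> 'b) set \<Rightarrow> nat \<Rightarrow> nat" where
  "semigroup_growth G n = card {s \<in> semigroup_generated G. word_length G s \<le> n}"


section \<open>The automaton \<open>I\<^sub>2\<close>\<close>

datatype letter = x0 | x1

datatype state = q0 | q1

fun I2_trans :: "state \<Rightarrow> letter \<Rightarrow> state" where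
  "I2_trans q0 x0 = q0"
| "I2_trans q0 x1 = q0"
| "I2_trans q1 x0 = q1"
| "I2_trans q1 x1 = q0"

fun I2_out :: "state \<Rightarrow> letter \<Rightarrow> letter" where
  "I2_out q0 x0 = x1"
| "I2_out q0 x1 = x0"
| "I2_out q1 x0 = x1"
| "I2_out q1 x1 = x1"

definition I2 :: "(state, letter) mealy" where
  "I2 = \<lparr>states = {q0, q1}, trans = I2_trans, out = I2_out\<rparr>"

definition f0 :: "letter stream \<Rightarrow> letter stream" where
  "f0 = mealy_map I2 q0"

definition f1 :: "letter stream \<Rightarrow> letter stream" where
  "f1 = mealy_map I2 q1"

lemma f0_f1_rec:
  "f0 (x0 ## u) = x1 ## f0 u"
  "f0 (x1 ## u) = x0 ## f0 u"
  "f1 (x0 ## u) = x1 ## f1 u"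
  "f1 (x1 ## u) = x1 ## f0 u"
  by (simp_all add: f0_def f1_def I2_def mealy_map_Cons)


section \<open>Consequences of the definitions\<close>

lemma mealy_map_power:
  "mealy_map (mealy_power A n) qs = comp_list (map (mealy_map A) qs)"
proof -
  have Nil: "mealy_map (mealy_power A n) [] u = u" for u
    by (coinduction arbitrary: u) (auto simp: mealy_power_def)
  have Cons: "mealy_map (mealy_power A n) (q # qs) u =
      mealy_map A q (mealy_map (mealy_power A n) qs u)" for q qs u
    by (coinduction arbitrary: q qs u) (auto simp: mealy_power_def)
  show ?thesis
    by (induction qs) (auto simp: comp_list_def Nil Cons fun_eq_iff)
qed

lemma mealy_automaton_power:
  assumes "mealy_automaton A"
  shows "mealy_automaton (mealy_power A n)"
proof -
  have fin: "finite (states A)" and ne: "states A \<noteq> {}"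
    and cl: "\<And>q x. q \<in> states A \<Longrightarrow> trans A q x \<in> states A"
    using assms by (auto simp: mealy_automaton_def)
  have "set (trans_list A qs x) \<subseteq> states A \<and> length (trans_list A qs x) = length qs"
    if "set qs \<subseteq> states A" for qs x
    using that by (induction qs) (auto simp: cl)
  moreover obtain q where "q \<in> states A"
    using ne by blast
  then have "set (replicate n q) \<subseteq> states A \<and> length (replicate n q) = n"
    by auto
  then have "{qs. set qs \<subseteq> states A \<and> length qs = n} \<noteq> {}"
    by blast
  ultimately show ?thesis
    using finite_lists_length_eq[OF fin, of n] by (auto simp: mealy_automaton_def mealy_power_def)
qed

lemma minimal_size_eq_card:
  assumes "mealy_automaton A"
  shows "minimal_size A = card (mealy_maps A)"
proof -
  let ?F = "mealy_maps A"
  have fin: "finite ?F" and ne: "?F \<noteq> {}"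
    using assms by (auto simp: mealy_automaton_def mealy_maps_def)
  obtain h :: "_ \<Rightarrow> nat" where h: "bij_betw h ?F {0..<card ?F}"
    using ex_bij_betw_finite_nat[OF fin] by blast
  have "\<forall>g\<in>?F. \<exists>q. q \<in> states A \<and> mealy_map A q = g"
    by (auto simp: mealy_maps_def)
  then obtain r where r: "\<And>g. g \<in> ?F \<Longrightarrow> r g \<in> states A \<and> mealy_map A (r g) = g"
    by metis
  define p where "p i = r (inv_into ?F h i)" for i
  define B where "B = \<lparr>states = {0..<card ?F},
      trans = (\<lambda>i x. h (mealy_map A (trans A (p i) x))), out = (\<lambda>i x. out A (p i) x)\<rparr>"
  have p: "p (h (mealy_map A q)) \<in> states A \<and> mealy_map A (p (h (mealy_map A q))) = mealy_map A q"
    if "q \<in> states A" for q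
    using that r h by (simp add: p_def mealy_maps_def bij_betw_inv_into_left)
  have p': "p i \<in> states A" if "i < card ?F" for i
    using that r h by (metis atLeastLessThan_iff bij_betw_def inv_into_into p_def zero_le)
  have cl: "trans A q x \<in> states A" if "q \<in> states A" for q x
    using assms that by (auto simp: mealy_automaton_def)
  have map_out: "out A q x = out A q' x"
    and map_trans: "mealy_map A (trans A q x) = mealy_map A (trans A q' x)"
    if "mealy_map A q = mealy_map A q'" for q q' x
  proof -
    have *: "mealy_map A q (x ## u) = mealy_map A q' (x ## u)" for u
      using that by simp
    show "out A q x = out A q' x"
      using * by (simp add: mealy_map_Cons)
    show "mealy_map A (trans A q x) = mealy_map A (trans A q' x)"
      using * by (simp add: mealy_map_Cons fun_eq_iff)
  qed
  have B_map: "mealy_map B (h (mealy_map A q)) u = mealy_map A q u" if "q \<in> states A" for q u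
    using that
  proof (coinduction arbitrary: q u)
    case (Eq_stream q u)
    have 1: "mealy_map A (p (h (mealy_map A q))) = mealy_map A q"
      using p[OF Eq_stream] by blast
    have 2: "mealy_map A (trans A (p (h (mealy_map A q))) (shd u)) = mealy_map A (trans A q (shd u))"
      by (rule map_trans[OF 1])
    show ?case
      using map_out[OF 1, of "shd u"] 2 cl[OF Eq_stream] by (auto simp: B_def)
  qed
  have mem: "h (mealy_map A q) < card ?F" if "q \<in> states A" for q
    using h that by (auto simp: bij_betw_def mealy_maps_def)
  have st: "states B = (\<lambda>q. h (mealy_map A q)) ` states A"
    using h by (auto simp: B_def bij_betw_def mealy_maps_def image_image)
  have "mealy_maps B = ?F"
    unfolding mealy_maps_def st image_image by (intro image_cong) (auto simp: B_map)
  moreover have "mealy_automaton B"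
    using ne fin p' cl mem by (auto simp: mealy_automaton_def B_def card_gt_0_iff)
  ultimately have ex: "mealy_automaton B \<and> mealy_equiv B A \<and> card (states B) = card ?F"
    by (simp add: mealy_equiv_def B_def)
  have "card ?F \<le> card (states C)" if "mealy_automaton C" "mealy_equiv C A"
    for C :: "(nat, 'b) mealy"
    using that unfolding mealy_automaton_def mealy_equiv_def mealy_maps_def
    by (metis card_image_le)
  with ex show ?thesis
    unfolding minimal_size_def by (intro Least_equality) auto
qed

lemma automaton_growth_eq_card:
  assumes "mealy_automaton A"
  shows "automaton_growth A n = card (comp_list ` {fs. set fs \<subseteq> mealy_maps A \<and> length fs = n})"
proof -
  have "{fs. set fs \<subseteq> mealy_maps A \<and> length fs = n} =
      map (mealy_map A) ` {qs. set qs \<subseteq> states A \<and> length qs = n}" (is "?L = ?R")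
  proof
    show "?L \<subseteq> ?R"
    proof
      fix fs assume "fs \<in> ?L"
      then have "fs \<in> lists (mealy_map A ` states A)" and "length fs = n"
        by (auto simp: mealy_maps_def)
      then obtain qs where "qs \<in> lists (states A)" "fs = map (mealy_map A) qs" "length qs = n"
        unfolding lists_image by (metis imageE length_map)
      then show "fs \<in> ?R"
        by auto
    qed
  qed (auto simp: mealy_maps_def subset_iff)
  then show ?thesis
    by (simp add: automaton_growth_def minimal_size_eq_card mealy_automaton_power assms
        mealy_maps_def[of "mealy_power A n"] mealy_map_power image_image)
       (simp add: mealy_power_def)
qed

lemma mealy_automaton_I2: "mealy_automaton I2"
proof -
  have "I2_trans q x \<in> {q0, q1}" for q x
    by (cases "I2_trans q x") auto
  then show ?thesis
    by (simp add: mealy_automaton_def I2_def)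
qed

lemma mealy_maps_I2: "mealy_maps I2 = {f0, f1}"
  by (simp add: mealy_maps_def f0_def f1_def I2_def)

lemma f0_f0: "f0 \<circ> f0 = id"
proof -
  have "f0 (f0 u) = u" for u
  proof (coinduction arbitrary: u)
    case (Eq_stream u)
    show ?case
      by (cases "shd u") (auto simp: f0_def I2_def)
  qed
  then show ?thesis
    by auto
qed

lemma id_in_semigroup: "id \<in> semigroup_generated {f0, f1}"
  using semigroup_generated.comp[of f0 "{f0, f1}" f0] by (simp add: f0_f0 semigroup_generated.gen)

text \<open>
  The infinite product in the growth series converges in the topology of formal power series.
\<close>

lemma convergent_prod_odd:
  "convergent_prod (\<lambda>n. 1 + fps_X ^ (2 * n + 1) :: rat fps)"
proof -
  define P :: "nat \<Rightarrow> rat fps" where "P n = (\<Prod>i\<le>n. 1 + fps_X ^ (2 * i + 1))" for n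
  have P_Suc: "P (Suc n) = P n + P n * fps_X ^ (2 * Suc n + 1)" for n
    by (simp only: P_def prod.atMost_Suc distrib_left mult_1_right)
  have P_step: "fps_nth (P (Suc n)) k = fps_nth (P n) k" if "k \<le> n" for n k
    using that by (simp only: P_Suc fps_add_nth fps_X_power_mult_right_nth) simp
  have stable: "fps_nth (P n) k = fps_nth (P k) k" if "k \<le> n" for n k
    using that
  proof (induction n rule: dec_induct)
    case (step n)
    then show ?case
      using P_step[of k n] by argo
  qed simp
  have "P \<longlonglongrightarrow> Abs_fps (\<lambda>k. fps_nth (P k) k)"
  proof (rule tendsto_fpsI)
    show "\<forall>\<^sub>F n in sequentially. fps_nth (P n) k = fps_nth (Abs_fps (\<lambda>k. fps_nth (P k) k)) k" for k
      using eventually_ge_at_top[of k] by eventually_elim (simp only: fps_nth_Abs_fps, rule stable)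
  qed
  moreover have "fps_nth (Abs_fps (\<lambda>k. fps_nth (P k) k)) 0 = 1"
    by (simp add: P_def)
  then have "Abs_fps (\<lambda>k. fps_nth (P k) k) \<noteq> 0"
    by (metis fps_zero_nth zero_neq_one)
  ultimately have "raw_has_prod (\<lambda>n. 1 + fps_X ^ (2 * n + 1) :: rat fps) 0 (Abs_fps (\<lambda>k. fps_nth (P k) k))"
    unfolding raw_has_prod_def P_def add_0_right by (rule conjI)
  then show ?thesis
    unfolding convergent_prod_def by blast
qed

end

theory Submission
  imports Defs
begin

text \<open>
  The generator \<open>f0\<close> complements every letter, and \<open>f1\<close> is \<open>f0\<close> followed by the map \<open>b\<close>
  that replaces the first \<open>x0\<close> of a word by \<open>x1\<close> (\<open>f1_eq\<close>). Conjugation by \<open>f0\<close> only exchanges the two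
  letters, so all complements in a product of \<open>n\<close> generators can be collected on its right, as
  \<open>f0 ^^ n\<close>. What remains is a map of a very rigid kind: for some finite word \<open>p\<close> and numbers \<open>i, j\<close> with
  \<open>i + j = length p\<close> it deletes the first \<open>i\<close> letters \<open>x0\<close> and the first \<open>j\<close> letters \<open>x1\<close> and
  then writes \<open>p\<close> in front. The triple \<open>(p, i, j)\<close> is determined by the map (\<open>act_inj\<close>), and
  multiplication by a generator from the left acts on triples by simple rules (\<open>words_eq\<close>).

  Counting transformations is therefore counting triples. The triples that come from products of \<open>n\<close>
  generators are exactly those of weight at most \<open>n\<close> (\<open>reachable_eq\<close>), where the weight is a
  sum of odd numbers \<open>2 * m - 1\<close>, one for each end \<open>m\<close> of a run of equal letters in \<open>p\<close>, of one
  more odd number for a deletion count, and of a correction for the first letter. The word \<open>p\<close> is given by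
  its first letter and its run ends, that is, by a set of distinct odd numbers; this is the source
  of the product of the factors \<open>1 + X^(2n + 1)\<close>. For a fixed length of \<open>p\<close> the
  generating function of the weight is explicit (\<open>level_series_Suc\<close>), and the sum over all lengths
  telescopes (\<open>sum_level_series\<close>).

  This gives the series of the automaton. Products of even and of odd length
  never agree, whereas \<open>f0\<close> being an involution allows lengthening by two, so the elements of length
  at most \<open>n\<close> are the disjoint union of the products of \<open>n\<close> and of \<open>n - 1\<close> generators. Hence
  \<open>1 + X\<close> times the automaton series is the series of the monoid, and a further factor \<open>1 - X\<close> gives
  the word growth series.
\<close>

section \<open>The generators as operations on infinite words\<close>

fun flip :: "letter \<Rightarrow> letter" where
  "flip x0 = x1"
| "flip x1 = x0"

lemma flip_flip [simp]: "flip (flip c) = c"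
  by (cases c) auto

lemma flip_neq [simp]: "flip c \<noteq> c" "c \<noteq> flip c"
  by (cases c; simp)+

lemma flip_eq_iff [simp]: "flip c = flip d \<longleftrightarrow> c = d"
  by (cases c; cases d) auto

text \<open>
  If \<open>c\<close> does not occur in \<open>u\<close>, nothing is removed; the corecursive form gives this limiting case
  without a case distinction.
\<close>

primcorec remove_first :: "letter \<Rightarrow> letter stream \<Rightarrow> letter stream" where
  "shd (remove_first c u) = (if shd u = c then shd (stl u) else shd u)"
| "stl (remove_first c u) = (if shd u = c then stl (stl u) else remove_first c (stl u))"

lemma remove_first_Cons [simp]: "remove_first c (y ## u) = (if y = c then u else y ## remove_first c u)"
  by (rule stream.expand) auto

text \<open>
  Over two letters, every head is removed by one of two removals of different letters, so both
  sides agree after one letter has been read.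
\<close>

lemma remove_first_commute: "remove_first c (remove_first d u) = remove_first d (remove_first c u)"
proof (cases u)
  case (SCons y v)
  then show ?thesis
    by (cases c; cases d; cases y) auto
qed

lemma remove_first_funpow_commute: "remove_first c ((remove_first d ^^ n) u) = (remove_first d ^^ n) (remove_first c u)"
  by (induction n) (simp_all add: remove_first_commute[of c d])

lemma remove_first_sconst [simp]: "remove_first c (sconst d) = sconst d"
proof (cases "c = d")
  case True
  have "sconst d = d ## sconst d"
    by (rule stream.expand) simp
  then show ?thesis
    by (metis True remove_first_Cons)
next
  case False
  have "u = sconst d \<Longrightarrow> remove_first c u = sconst d" for u
    by (coinduction arbitrary: u) (use False in auto)
  then show ?thesis by blast
qed

lemma remove_first_funpow_sconst [simp]: "(remove_first c ^^ n) (sconst d) = sconst d"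
  by (induction n) (simp, metis comp_apply funpow.simps(2) remove_first_sconst)

lemma f0_Cons [simp]: "f0 (y ## u) = flip y ## f0 u"
  by (cases y) (simp_all add: f0_f1_rec)

lemma f0_sel [simp]: "shd (f0 u) = flip (shd u)" "stl (f0 u) = f0 (stl u)"
  by (cases u; simp)+

lemma f0_f0_apply [simp]: "f0 (f0 u) = u"
  using f0_f0 by (metis comp_apply id_apply)

lemma f0_shift: "f0 (p @- u) = map flip p @- f0 u"
  by (induction p) auto

lemma f0_sconst [simp]: "f0 (sconst c) = sconst (flip c)"
proof -
  have "u = sconst c \<Longrightarrow> f0 u = sconst (flip c)" for u
    by (coinduction arbitrary: u) auto
  then show ?thesis by blast
qed

lemma f0_remove_first: "f0 (remove_first c u) = remove_first (flip c) (f0 u)"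
  by (coinduction arbitrary: u rule: stream.coinduct_strong) auto

lemma f0_remove_first_funpow: "f0 ((remove_first c ^^ n) u) = (remove_first (flip c) ^^ n) (f0 u)"
  by (induction n arbitrary: u) (auto simp: f0_remove_first)

text \<open>
  The automaton started in \<open>q1\<close> emits \<open>x1\<close> up to and including the first \<open>x1\<close> of its input and
  complements the rest. Read in terms of the complement \<open>f0 u\<close>, its first \<open>x0\<close> is replaced by
  \<open>x1\<close>; since only letters \<open>x1\<close> precede that \<open>x0\<close>, this is the same as deleting it and putting
  an \<open>x1\<close> in front.
\<close>

lemma f1_eq: "f1 u = x1 ## remove_first x0 (f0 u)"
proof (coinduction arbitrary: u rule: stream.coinduct_strong)
  case (Eq_stream u)
  show ?case
  proof (cases u)
    case (SCons y v)
    then show ?thesis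
      by (cases y) (auto simp: f0_f1_rec)
  qed
qed

section \<open>Normal forms of products\<close>

text \<open>
  A triple \<open>(p, i, j)\<close> stands for the map that deletes the first \<open>i\<close> letters \<open>x0\<close> and the first
  \<open>j\<close> letters \<open>x1\<close> and writes \<open>p\<close> in front. Only triples with \<open>length p = i + j\<close> arise from
  products of generators: each letter of \<open>p\<close> takes the place of a deleted one.
\<close>

type_synonym code = "letter list \<times> nat \<times> nat"

fun act :: "code \<Rightarrow> letter stream \<Rightarrow> letter stream" where
  "act (p, i, j) u = p @- (remove_first x0 ^^ i) ((remove_first x1 ^^ j) u)"

fun valid :: "code \<Rightarrow> bool" where
  "valid (p, i, j) \<longleftrightarrow> length p = i + j"

fun swap :: "code \<Rightarrow> code" where
  "swap (p, i, j) = (map flip p, j, i)"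

text \<open>
  The action of the map that replaces the first \<open>x0\<close> by \<open>x1\<close> on the written prefix of a code. If the prefix
  has no \<open>x0\<close>, the map reaches into the tail, which loses its first \<open>x0\<close>
  while an \<open>x1\<close> is added to the prefix; this is why \<open>push\<close> raises the number of deleted \<open>x0\<close>
  exactly then.
\<close>

fun fill :: "letter list \<Rightarrow> letter list" where
  "fill [] = [x1]"
| "fill (x0 # p) = x1 # p"
| "fill (x1 # p) = x1 # fill p"

fun push :: "code \<Rightarrow> code" where
  "push (p, i, j) = (fill p, if x0 \<in> set p then i else Suc i, j)"

lemma fill_first_shift: "x1 ## remove_first x0 (p @- v) = fill p @- (if x0 \<in> set p then v else remove_first x0 v)"
  by (induction p rule: fill.induct) auto

lemma act_swap: "f0 (act t u) = act (swap t) (f0 u)"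
proof (cases t)
  case (fields p i j)
  have "(remove_first x1 ^^ i) ((remove_first x0 ^^ j) v) = (remove_first x0 ^^ j) ((remove_first x1 ^^ i) v)" for v
    by (induction i) (auto simp: remove_first_funpow_commute)
  then show ?thesis
    by (simp add: fields f0_shift f0_remove_first_funpow)
qed

lemma act_push: "x1 ## remove_first x0 (act t u) = act (push t) u"
  by (cases t) (auto simp: fill_first_shift)

lemma f1_act: "f1 (act t u) = act (push (swap t)) (f0 u)"
  by (simp add: f1_eq act_swap act_push)

text \<open>
  A prefix is recovered from its two constant continuations: if one prefix were shorter, its
  continuation would take both letter values at a position where the longer one is fixed.
\<close>

lemma shift_sconst_eqD:
  assumes "p @- sconst x0 = q @- sconst x0" "p @- sconst x1 = q @- sconst x1"
  shows "p = q"
proof -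
  have *: "\<not> length p < length q"
    if "p @- sconst x0 = q @- sconst x0" "p @- sconst x1 = q @- sconst x1" for p q
  proof
    assume l: "length p < length q"
    have "(p @- sconst c) !! length p = c" for c :: letter
      by (simp add: shift_snth_ge)
    moreover have "(q @- sconst c) !! length p = q ! length p" for c :: letter
      using l by simp
    ultimately show False
      using that by (metis letter.distinct(1))
  qed
  from assms have "length p = length q"
    using *[of p q] *[of q p] by simp
  with arg_cong[OF assms(1), of "stake (length p)"] show ?thesis
    by (simp add: stake_shift)
qed

lemma remove_first_replicate:
  "(remove_first x0 ^^ i) ((remove_first x1 ^^ j) (replicate (i + k) x0 @- sconst x1)) = replicate k x0 @- sconst x1"
proof -
  have "remove_first x1 (replicate n x0 @- sconst x1) = replicate n x0 @- sconst x1" for n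
    by (induction n) (metis replicate_0 shift.simps(1) remove_first_sconst, simp)
  then have "(remove_first x1 ^^ j) (replicate n x0 @- sconst x1) = replicate n x0 @- sconst x1" for n
    by (induction j) auto
  moreover have "(remove_first x0 ^^ i) (replicate (i + k) x0 @- sconst x1) = replicate k x0 @- sconst x1"
    by (induction i) (auto simp: funpow_swap1)
  ultimately show ?thesis
    by simp
qed

lemma replicate_sconst_inj:
  assumes "replicate k x0 @- sconst x1 = replicate l x0 @- sconst x1"
  shows "k = l"
  using assms
proof (induction k arbitrary: l)
  case 0
  then show ?case
    by (cases l) (auto dest: arg_cong[of _ _ shd])
next
  case (Suc k)
  then show ?case
    by (cases l) (auto dest: arg_cong[of _ _ shd])
qed

text \<open>
  The constant words survive all deletions, so they exhibit the prefix \<open>p\<close>. The word that consists of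
  \<open>i + i'\<close> letters \<open>x0\<close> followed by \<open>x1\<close> forever loses exactly \<open>i\<close> of its \<open>x0\<close>, which
  exhibits \<open>i\<close>; the length of \<open>p\<close> then gives \<open>j\<close>.
\<close>

lemma act_inj:
  assumes "act t = act t'" "valid t" "valid t'"
  shows "t = t'"
proof -
  obtain p i j where t: "t = (p, i, j)" by (cases t)
  obtain p' i' j' where t': "t' = (p', i', j')" by (cases t')
  have "p = p'"
    using fun_cong[OF assms(1), of "sconst x0"] fun_cong[OF assms(1), of "sconst x1"]
    by (intro shift_sconst_eqD) (simp_all add: t t')
  moreover have "i = i'"
  proof -
    have "replicate i' x0 @- sconst x1 = replicate i x0 @- sconst x1"
      using fun_cong[OF assms(1), of "replicate (i + i') x0 @- sconst x1"]
        remove_first_replicate[of i j i'] remove_first_replicate[of i' j' i] \<open>p = p'\<close>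
      by (simp add: t t' add.commute)
    then show ?thesis
      using replicate_sconst_inj by metis
  qed
  ultimately show ?thesis
    using assms(2,3) by (simp add: t t')
qed

text \<open>
  On the constant word \<open>x0\<close> one side is eventually \<open>x0\<close> and the other eventually \<open>x1\<close>. Hence
  products of even and of odd length never coincide.
\<close>

lemma act_neq_act_f0: "act t \<noteq> act t' \<circ> f0"
proof
  assume "act t = act t' \<circ> f0"
  then have "act t (sconst x0) = act t' (f0 (sconst x0))"
    by simp
  then obtain p q where e: "p @- sconst x0 = q @- sconst x1"
    by (cases t; cases t') auto
  have "(p @- sconst x0) !! (length p + length q) = x0"
    by (simp add: shift_snth_ge)
  moreover have "(q @- sconst x1) !! (length p + length q) = x1"
    by (simp add: shift_snth_ge)
  ultimately show False
    using e by simp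
qed

section \<open>Normal forms of products of a given length\<close>

primrec reachable :: "nat \<Rightarrow> code set" where
  "reachable 0 = {([], 0, 0)}"
| "reachable (Suc n) = swap ` reachable n \<union> push ` swap ` reachable n"

lemma length_fill: "length (fill p) = (if x0 \<in> set p then length p else Suc (length p))"
  by (induction p rule: fill.induct) auto

lemma valid_swap [simp]: "valid (swap t) \<longleftrightarrow> valid t"
  by (cases t) auto

lemma valid_push: "valid t \<Longrightarrow> valid (push t)"
  by (cases t) (auto simp: length_fill)

definition words :: "nat \<Rightarrow> (letter stream \<Rightarrow> letter stream) set" where
  "words n = comp_list ` {fs. set fs \<subseteq> {f0, f1} \<and> length fs = n}"

lemma words_0: "words 0 = {id}"
  by (auto simp: words_def comp_list_def)

lemma words_Suc: "words (Suc n) = (\<circ>) f0 ` words n \<union> (\<circ>) f1 ` words n"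
proof -
  have "{fs. set fs \<subseteq> {f0, f1} \<and> length fs = Suc n} =
    (#) f0 ` {fs. set fs \<subseteq> {f0, f1} \<and> length fs = n} \<union> (#) f1 ` {fs. set fs \<subseteq> {f0, f1} \<and> length fs = n}"
    by (auto simp: length_Suc_conv)
  then show ?thesis
    by (simp add: words_def image_Un image_image comp_list_def)
qed

text \<open>
  Moving all complements to the right of the product turns the generator \<open>f0\<close> into \<open>swap\<close> and the
  generator \<open>f1\<close> into \<open>swap\<close> followed by \<open>push\<close>, and leaves \<open>f0 ^^ n\<close> as the rightmost factor.
\<close>

lemma words_eq: "words n = (\<lambda>t. act t \<circ> f0 ^^ n) ` reachable n"
proof (induction n)
  case 0
  then show ?case by (auto simp: words_0)
next
  case (Suc n)
  have "f0 \<circ> (act t \<circ> f0 ^^ n) = act (swap t) \<circ> f0 ^^ Suc n"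
    and "f1 \<circ> (act t \<circ> f0 ^^ n) = act (push (swap t)) \<circ> f0 ^^ Suc n" for t
    by (auto simp: act_swap f1_act)
  then show ?case
    by (simp only: words_Suc Suc reachable.simps image_Un image_image)
qed

section \<open>The weight of a normal form\<close>

text \<open>
  A run of equal letters in \<open>p\<close> that ends at position \<open>m\<close>, counted from 1, contributes \<open>2 * m - 1\<close>; the
  parameter \<open>k\<close> is the number of letters that precede the list. The reason for this value: write
  \<open>b\<close> for the map that replaces the first \<open>x0\<close> by \<open>x1\<close>, and \<open>a\<close> for the one with the letters exchanged.
  The prefix \<open>p\<close> with run ends \<open>m1 < m2 < ...\<close> is written by the product of powers of \<open>a\<close> and \<open>b\<close>
  alternately, with exponents \<open>m1, m2, ...\<close> from left to right. A product of \<open>n\<close> generators is, up to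
  a power of \<open>f0\<close> on the right, a subword of the alternating word \<open>b a b a ...\<close> of length \<open>n\<close>, and
  a block of \<open>m\<close> equal letters occupies \<open>2 * m - 1\<close> positions of it.
\<close>

fun run_weight :: "nat \<Rightarrow> letter list \<Rightarrow> nat" where
  "run_weight k [] = 0"
| "run_weight k (x # p) = (if p = [] \<or> hd p \<noteq> x then 2 * k + 1 else 0) + run_weight (Suc k) p"

text \<open>
  For valid codes, the least \<open>n\<close> with \<open>(p, i, j) \<in> reachable n\<close>, as \<open>reachable_eq\<close> shows. Besides the blocks that write
  \<open>p\<close> there is one rightmost block, whose exponent is the number of deletions of the letter that ends \<open>p\<close>;
  truncated subtraction makes it free when that number is 0. The last summand is the
  position lost when the word starts with \<open>a\<close> instead of \<open>b\<close>.
\<close>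

fun weight :: "code \<Rightarrow> nat" where
  "weight (p, i, j) = (if p = [] then 0
     else run_weight 0 p + (2 * (if last p = x0 then i else j) - 1) + (if hd p = x0 then 1 else 0))"

lemma run_weight_replicate: "run_weight k (replicate m c @ flip c # r) =
    (if m = 0 then 0 else 2 * (k + m) - 1) + run_weight (k + m) (flip c # r)"
proof (induction m arbitrary: k)
  case (Suc m)
  show ?case
    using Suc.IH[of "Suc k"] by (cases m) simp_all
qed simp

lemma run_weight_replicate_all: "run_weight k (replicate m c) = (if m = 0 then 0 else 2 * (k + m) - 1)"
proof (induction m arbitrary: k)
  case (Suc m)
  show ?case
    using Suc.IH[of "Suc k"] by (cases m) simp_all
qed simp

lemma fill_replicate: "fill (replicate m x1) = replicate (Suc m) x1"
  by (induction m) auto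

lemma fill_replicate_x0: "fill (replicate m x1 @ x0 # r) = replicate m x1 @ x1 # r"
  by (induction m) auto

lemma run_weight_map_flip: "run_weight k (map flip p) = run_weight k p"
  by (induction p arbitrary: k) (auto simp: hd_map)

lemma x1_prefix_cases:
  obtains m where "p = replicate m x1" | m r where "p = replicate m x1 @ x0 # r"
proof (induction p arbitrary: thesis)
  case Nil
  then show ?case by (metis replicate_0)
next
  case (Cons c p)
  show ?case
  proof (cases c)
    case x0
    then show ?thesis using Cons.prems(2)[of 0 p] by simp
  next
    case x1
    then show ?thesis
      using Cons.IH Cons.prems(1)[of "Suc _"] Cons.prems(2)[of "Suc _"] by (metis append_Cons replicate_Suc)
  qed
qed


text \<open>
  The swap leaves the run ends alone and exchanges the letter that ends \<open>p\<close> together with the deletion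
  counts, so only the summand for the first letter changes.
\<close>

lemma weight_swap:
  "p \<noteq> [] \<Longrightarrow> weight (swap (p, i, j)) + (if hd p = x0 then 1 else 0) = weight (p, i, j) + (if hd p = x0 then 0 else 1)"
  by (cases "hd p"; cases "last p") (simp_all add: run_weight_map_flip hd_map last_map)

lemma weight_replicate_x1:
  "weight (replicate m x1, i, j) = (if m = 0 then 0 else 2 * m - 1 + (2 * j - 1))"
  by (auto simp: run_weight_replicate_all)

text \<open>
  The first run gets longer by one letter: its end moves one position on, which costs 2, unless
  the next run had length 1, in which case two run ends disappear. If that next run was also the
  last one, the final letter changes and with it the deletion count that is weighed; the
  lost run end at the last-but-one position and \<open>i + j = length p\<close> pay for this.
\<close>

lemma weight_push_x1:
  assumes "valid (p, i, j)" "p \<noteq> []" "hd p = x1"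
  shows "weight (push (p, i, j)) \<le> weight (p, i, j) + 2"
proof (rule x1_prefix_cases[of p])
  fix m assume p: "p = replicate m x1"
  have "push (p, i, j) = (replicate (Suc m) x1, Suc i, j)"
    unfolding p by (simp add: fill_replicate)
  then show ?thesis
    using assms(2) by (simp only: p weight_replicate_x1) auto
next
  fix m r assume p: "p = replicate m x1 @ x0 # r"
  have m: "m > 0"
    using assms(3) by (cases m) (auto simp: p)
  have push: "push (p, i, j) = (replicate m x1 @ x1 # r, i, j)"
    unfolding p by (simp add: fill_replicate_x0)
  show ?thesis
  proof (cases r)
    case Nil
    then have "length p = Suc m" "last p = x0" "hd p = x1"
      using assms(3) by (auto simp: p)
    have 1: "push (p, i, j) = (replicate (Suc m) x1, i, j)"
      unfolding push by (simp add: Nil replicate_append_same)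
    have "weight (p, i, j) = 2 * m - 1 + (2 * m + 1) + (2 * i - 1)"
      using m run_weight_replicate[of 0 m x1 "[]"] assms(3) by (simp add: p Nil)
    moreover have "i + j = Suc m"
      using assms(1) \<open>length p = Suc m\<close> by simp
    ultimately show ?thesis
      unfolding 1 weight_replicate_x1 using m by auto
  next
    case (Cons c r')
    have l: "last (replicate m x1 @ x1 # r) = last p" and h: "hd (replicate m x1 @ x1 # r) = x1"
      using m by (auto simp: p Cons hd_append)
    have b: "run_weight 0 (replicate m x1 @ x1 # r) \<le> run_weight 0 p + 2"
    proof (cases c)
      case x0
      have "run_weight 0 (replicate m x1 @ x1 # r) = 2 * m + 1 + run_weight (Suc m) r"
        using run_weight_replicate[of 0 "Suc m" x1 r'] by (simp add: Cons x0 replicate_app_Cons_same)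
      moreover have "run_weight 0 p = 2 * m - 1 + run_weight (Suc m) r"
        using run_weight_replicate[of 0 m x1 r] m by (simp add: p Cons x0)
      ultimately show ?thesis using m by simp
    next
      case x1
      have "run_weight k (replicate m x1 @ x1 # r) = run_weight (k + m) (x1 # r)" for k
        by (induction m arbitrary: k) (auto simp: Cons x1 hd_append)
      then show ?thesis
        using run_weight_replicate[of 0 m x1 r] m by (simp add: p Cons x1)
    qed
    show ?thesis
      unfolding push weight.simps l h using b assms(3) by (auto simp: p)
  qed
qed

text \<open>
  A new run of length 1 costs exactly what the initial \<open>x0\<close> cost; if the second letter is
  \<open>x1\<close>, the first two runs merge instead. In a prefix of one letter the deletion counts 0 and 1 have to be
  compared with the initial letter as well.
\<close>

lemma weight_push_x0:
  assumes "valid (x0 # p, i, j)"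
  shows "weight (push (x0 # p, i, j)) \<le> weight (x0 # p, i, j)"
proof (cases p)
  case Nil
  then show ?thesis using assms by (cases i) auto
next
  case (Cons c r)
  then show ?thesis by (cases c) auto
qed

lemma reachable_sound: "t \<in> reachable n \<Longrightarrow> valid t \<and> weight t \<le> n"
proof (induction n arbitrary: t)
  case (Suc n)
  from Suc.prems obtain s where s: "s \<in> reachable n" "t = swap s \<or> t = push (swap s)"
    by auto
  obtain p i j where f: "swap s = (p, i, j)"
    by (cases "swap s")
  then have g: "s = swap (p, i, j)"
    by (cases s) (auto simp: comp_def)
  have v: "valid (p, i, j)" and w: "weight (swap (p, i, j)) \<le> n"
    using Suc.IH[OF s(1)] by (auto simp: g simp del: weight.simps)
  show ?case
  proof (cases p)
    case Nil
    then show ?thesis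
      using v s(2) by (auto simp: f)
  next
    case (Cons c p')
    note sw = weight_swap[of p i j]
    show ?thesis
    proof (cases c)
      case x0
      then show ?thesis
        using s(2) v w sw weight_push_x0[of p' i j] valid_push[OF v]
        by (auto simp: f Cons simp del: weight.simps push.simps swap.simps)
    next
      case x1
      then show ?thesis
        using s(2) v w sw weight_push_x1[OF v] valid_push[OF v]
        by (auto simp: f Cons simp del: weight.simps push.simps swap.simps)
    qed
  qed
qed auto

lemma swap_swap [simp]: "swap (swap t) = t"
  by (cases t) (auto simp: comp_def)

lemma push_in_reachable: "swap t \<in> reachable n \<Longrightarrow> push t \<in> reachable (Suc n)"
  by (metis reachable.simps(2) UnI2 image_eqI swap_swap)

lemma swap_in_reachable: "swap t \<in> reachable n \<Longrightarrow> t \<in> reachable (Suc n)"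
  by (metis reachable.simps(2) UnI1 image_eqI swap_swap)


lemma run_weight_ge: "p \<noteq> [] \<Longrightarrow> 2 * (k + length p) - 1 \<le> run_weight k p"
proof (induction p arbitrary: k)
  case (Cons c p)
  then show ?case
    using Cons.IH[of "Suc k"] by (cases "p = []") (auto intro: order_trans)
qed simp

lemma length_le_weight: "length (fst t) \<le> weight t"
proof (cases t)
  case (fields p i j)
  then show ?thesis
    using run_weight_ge[of p 0] by (cases p) auto
qed

text \<open>
  A valid code with nonempty \<open>p\<close> is obtained in one step from a valid code of smaller weight. If \<open>p\<close> starts
  with \<open>x0\<close>, that step is \<open>swap\<close>. If \<open>p\<close> starts with \<open>x1\<close>, it is \<open>push\<close> after \<open>swap\<close>, and the
  argument of \<open>push\<close> is found by cutting off the last letter of the first run of \<open>p\<close> or turning it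
  into \<open>x0\<close>.
\<close>

lemma reachable_complete: "valid t \<Longrightarrow> weight t \<le> n \<Longrightarrow> t \<in> reachable n"
proof (induction n arbitrary: t)
  case 0
  obtain p i j where t: "t = (p, i, j)" by (cases t)
  have "p = []"
    using 0 length_le_weight[of t] by (simp add: t del: weight.simps)
  then show ?case using 0 by (simp add: t)
next
  case (Suc n)
  obtain p i j where t: "t = (p, i, j)" by (cases t)
  have v: "valid (p, i, j)" and w: "weight (p, i, j) \<le> Suc n"
    using Suc.prems by (simp_all only: t)
  have reach: ?case
    if "t = push (q, k, l)" "valid (q, k, l)" "weight (swap (q, k, l)) \<le> n" for q k l
    using that Suc.IH[of "swap (q, k, l)"] push_in_reachable[of "(q, k, l)" n] by (simp only: valid_swap)
  show ?case
  proof (cases "p = []")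
    case True
    then show ?thesis
      using v by (intro swap_in_reachable Suc.IH) (auto simp: t)
  next
    case False
    show ?thesis
    proof (cases "hd p")
      case x0
      then show ?thesis
        using weight_swap[OF False, of i j] v w
        by (intro swap_in_reachable Suc.IH) (simp_all only: t valid_swap, simp)
    next
      case x1
      show ?thesis
      proof (rule x1_prefix_cases[of p])
        fix m assume p: "p = replicate m x1"
        have m: "m > 0" "i + j = m" and w': "2 * m - 1 + (2 * j - 1) \<le> Suc n"
          using False v w by (auto simp: p weight_replicate_x1 simp del: weight.simps)
        show ?thesis
        proof (cases "i > 0")
          case True
          \<comment> \<open>Here \<open>push\<close> appends the last \<open>x1\<close> and deletes one more \<open>x0\<close> of the tail.\<close>
          let ?q = "(replicate (m - 1) x1, i - 1, j)"
          have 1: "t = push ?q" "valid ?q"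
            using m True by (auto simp: t p fill_replicate simp flip: replicate_Suc)
          moreover have "weight (swap ?q) \<le> n"
          proof (cases "m = 1")
            case False
            then have "weight (swap ?q) \<le> weight ?q + 1"
              using m weight_swap[of "replicate (m - 1) x1" "i - 1" j] by simp
            then show ?thesis
              using False m w' by (simp add: weight_replicate_x1 del: weight.simps swap.simps)
          qed (use m True in auto)
          ultimately show ?thesis by (rule reach)
        next
          case i: False
          \<comment> \<open>No \<open>x0\<close> of the tail is deleted, so the last \<open>x1\<close> has to overwrite an \<open>x0\<close>.\<close>
          let ?q = "(replicate (m - 1) x1 @ [x0], i, j)"
          have "t = push ?q" "valid ?q"
            using m i by (auto simp: t p fill_replicate_x0 replicate_append_same simp flip: replicate_Suc)
          moreover have "weight (swap ?q) \<le> n"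
          proof (cases "m = 1")
            case False
            then have "weight (swap ?q) \<le> weight ?q + 1"
              using m weight_swap[of "replicate (m - 1) x1 @ [x0]" i j] by (simp add: hd_append)
            moreover have "weight ?q = 2 * (m - 1) - 1 + (2 * m - 1)"
              using run_weight_replicate[of 0 "m - 1" x1 "[]"] False m i by (simp add: hd_append)
            ultimately show ?thesis
              using False m w' i by simp
          qed (use m i w' in auto)
          ultimately show ?thesis by (rule reach)
        qed
      next
        fix m r assume p: "p = replicate m x1 @ x0 # r"
        have m: "m > 0"
          using x1 by (cases m) (auto simp: p)
        let ?p = "replicate (m - 1) x1 @ x0 # x0 # r"
        let ?q = "(?p, i, j)"
        have "t = push ?q" "valid ?q"
          using m v by (auto simp: t p fill_replicate_x0 replicate_app_Cons_same simp flip: replicate_Suc append_Cons)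
        moreover have "weight (swap ?q) \<le> n"
        proof -
          have l: "last ?p = last p" by (simp add: p)
          have b: "run_weight 0 p = 2 * m - 1 + run_weight m (x0 # r)"
            using m run_weight_replicate[of 0 m x1 r] by (simp add: p)
          have b': "run_weight 0 ?p = (if m = 1 then 0 else 2 * (m - 1) - 1) + run_weight m (x0 # r)"
            using m run_weight_replicate[of 0 "m - 1" x1 "x0 # r"] by simp
          define e where "e = 2 * (if last p = x0 then i else j) - 1"
          have "weight (p, i, j) = run_weight 0 p + e"
            using False x1 by (simp add: e_def)
          moreover have "weight ?q = run_weight 0 ?p + e + (if hd ?p = x0 then 1 else 0)"
            unfolding weight.simps l e_def by simp
          moreover have "hd ?p = x0 \<longleftrightarrow> m = 1"
            using m by (auto simp: hd_append)
          ultimately show ?thesis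
            using weight_swap[of ?p i j] w b b' m
            by (cases "m = 1") (simp_all del: swap.simps run_weight.simps weight.simps, linarith)
        qed
        ultimately show ?thesis by (rule reach)
      qed
    qed
  qed
qed

lemma reachable_eq: "reachable n = {t. valid t \<and> weight t \<le> n}"
  using reachable_sound reachable_complete by blast

lemma finite_reachable: "finite (reachable n)"
  by (induction n) auto

section \<open>Growth functions as numbers of normal forms\<close>

lemma f0_funpow_cancel:
  assumes "g \<circ> f0 ^^ n = h \<circ> f0 ^^ n"
  shows "g = h"
proof
  fix v
  have "(f0 ^^ n) ((f0 ^^ n) v) = v"
    by (induction n arbitrary: v) (simp_all add: funpow_swap1)
  then show "g v = h v"
    using fun_cong[OF assms, of "(f0 ^^ n) v"] by simp
qed

lemma card_words: "card (words n) = card (reachable n)"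
proof -
  have "inj_on (\<lambda>t. act t \<circ> f0 ^^ n) (reachable n)"
  proof (rule inj_onI)
    fix t t' assume "t \<in> reachable n" "t' \<in> reachable n" "act t \<circ> f0 ^^ n = act t' \<circ> f0 ^^ n"
    then show "t = t'"
      using act_inj[OF f0_funpow_cancel] unfolding reachable_eq by blast
  qed
  then show ?thesis
    unfolding words_eq by (rule card_image)
qed

lemma words_disjoint: "words n \<inter> words (Suc n) = {}"
proof -
  have False if "act t \<circ> f0 ^^ n = act t' \<circ> f0 ^^ Suc n" for t t'
  proof -
    have "act t \<circ> f0 ^^ n = (act t' \<circ> f0) \<circ> f0 ^^ n"
      using that by (simp add: comp_assoc)
    then show False
      using f0_funpow_cancel act_neq_act_f0 by blast
  qed
  then show ?thesis
    unfolding words_eq by blast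
qed

text \<open>
  Since \<open>f0\<close> is an involution, a product can be lengthened by two factors; by \<open>words_disjoint\<close> it
  cannot be lengthened by one.
\<close>

lemma words_mono2: "words n \<subseteq> words (Suc (Suc n))"
proof
  fix w assume w: "w \<in> words n"
  have "f0 \<circ> (f0 \<circ> w) \<in> words (Suc (Suc n))"
    using w by (auto simp: words_Suc)
  then show "w \<in> words (Suc (Suc n))"
    by (simp add: f0_f0 flip: comp_assoc)
qed

lemma words_le: "l \<le> n \<Longrightarrow> w \<in> words l \<Longrightarrow> w \<in> words n \<union> words (n - 1)"
proof (induction n rule: dec_induct)
  case (step n)
  then show ?case
    using words_mono2[of "n - 1"] by (cases n) auto
qed simp

lemma comp_list_append: "comp_list (xs @ ys) = comp_list xs \<circ> comp_list ys"
  by (induction xs) (auto simp: comp_list_def)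

lemma words_comp: "f \<in> words m \<Longrightarrow> g \<in> words n \<Longrightarrow> f \<circ> g \<in> words (m + n)"
  unfolding words_def by (force simp flip: comp_list_append)

lemma semigroup_eq: "semigroup_generated {f0, f1} = (\<Union>n. words n)"
proof (intro equalityI subsetI)
  fix w assume "w \<in> semigroup_generated {f0, f1}"
  then show "w \<in> (\<Union>n. words n)"
  proof induction
    case (gen f)
    have "f = comp_list [f]"
      by (simp add: comp_list_def)
    with gen have "f \<in> words 1"
      unfolding words_def by fastforce
    then show ?case by blast
  next
    case (comp f g)
    then show ?case using words_comp by blast
  qed
next
  fix w assume "w \<in> (\<Union>n. words n)"
  then obtain n where "w \<in> words n" by blast
  then show "w \<in> semigroup_generated {f0, f1}"
  proof (induction n arbitrary: w)
    case 0
    then show ?case using id_in_semigroup by (metis words_0 singletonD)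
  next
    case (Suc n)
    then show ?case
      by (auto simp: words_Suc intro: semigroup_generated.intros)
  qed
qed

lemma word_length_eq:
  "word_length {f0, f1} w = (if w = id then 0 else LEAST l. l > 0 \<and> w \<in> words l)"
proof -
  have "(\<exists>fs. length fs = l \<and> set fs \<subseteq> {f0, f1} \<and> w = comp_list fs) \<longleftrightarrow> w \<in> words l" for l
    by (auto simp: words_def)
  then show ?thesis
    by (simp only: word_length_def)
qed

text \<open>
  A product of \<open>l\<close> generators is also one of \<open>n\<close> or of \<open>n - 1\<close> generators for every \<open>n \<ge> l\<close>, according to
  parity, so balls in the word metric are unions of two consecutive sets \<open>words\<close>. For \<open>n = 0\<close> both are \<open>words 0\<close>.
\<close>

lemma word_length_le_iff:
  assumes "w \<in> semigroup_generated {f0, f1}"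
  shows "word_length {f0, f1} w \<le> n \<longleftrightarrow> w \<in> words n \<union> words (n - 1)"
proof (cases "w = id")
  case True
  then show ?thesis
    using words_le[of 0 n w] by (simp add: word_length_eq words_0)
next
  case False
  obtain l0 where "w \<in> words l0"
    using assms by (auto simp: semigroup_eq)
  moreover have pos: "l > 0" if "w \<in> words l" for l
    using that False by (cases l) (auto simp: words_0)
  ultimately have 1: "w \<in> words (word_length {f0, f1} w)"
    using False LeastI[of "\<lambda>l. l > 0 \<and> w \<in> words l" l0] by (simp add: word_length_eq)
  have 2: "word_length {f0, f1} w \<le> l" if "w \<in> words l" for l
    using that pos False by (auto simp: word_length_eq intro: Least_le)
  show ?thesis
  proof
    show "word_length {f0, f1} w \<le> n \<Longrightarrow> w \<in> words n \<union> words (n - 1)"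
      using words_le 1 by blast
    show "w \<in> words n \<union> words (n - 1) \<Longrightarrow> word_length {f0, f1} w \<le> n"
      using 2[of n] 2[of "n - 1"] by auto
  qed
qed

lemma words_of_length_le: "{w \<in> semigroup_generated {f0, f1}. word_length {f0, f1} w \<le> n} = words n \<union> words (n - 1)"
  using word_length_le_iff by (auto simp: semigroup_eq)

lemma finite_words: "finite (words n)"
  by (simp add: words_eq finite_reachable)

lemma semigroup_growth_0: "semigroup_growth {f0, f1} 0 = card (reachable 0)"
  by (simp only: semigroup_growth_def words_of_length_le) (simp add: card_words del: reachable.simps)

lemma semigroup_growth_Suc: "semigroup_growth {f0, f1} (Suc n) = card (reachable (Suc n)) + card (reachable n)"
  unfolding semigroup_growth_def words_of_length_le
  using words_disjoint[of n] by (simp add: card_Un_disjoint finite_words card_words Int_commute del: reachable.simps)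

lemma word_growth_0: "word_growth {f0, f1} 0 = semigroup_growth {f0, f1} 0"
  by (simp add: word_growth_def semigroup_growth_def)

lemma word_growth_Suc:
  "semigroup_growth {f0, f1} (Suc n) = semigroup_growth {f0, f1} n + word_growth {f0, f1} (Suc n)"
proof -
  let ?B = "\<lambda>n. {w \<in> semigroup_generated {f0, f1}. word_length {f0, f1} w \<le> n}"
  let ?S = "{w \<in> semigroup_generated {f0, f1}. word_length {f0, f1} w = Suc n}"
  have "?B (Suc n) = ?B n \<union> ?S"
    by auto
  moreover have "finite (?B (Suc n))"
    by (simp only: words_of_length_le finite_Un finite_words)
  moreover have "?B n \<inter> ?S = {}"
    by auto
  ultimately show ?thesis
    unfolding semigroup_growth_def word_growth_def
    by (simp only: finite_Un card_Un_disjoint)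
qed

lemma automaton_growth_I2: "automaton_growth I2 n = card (reachable n)"
  by (simp add: automaton_growth_eq_card mealy_automaton_I2 mealy_maps_I2 card_words flip: words_def)


section \<open>The generating function of the weight\<close>

lemma fps_sum_weight_nth:
  "finite A \<Longrightarrow> fps_nth (\<Sum>t\<in>A. fps_X ^ weight t :: rat fps) n = of_nat (card {t \<in> A. weight t = n})"
  by (simp add: fps_sum_nth fps_X_power_nth eq_commute[of n] flip: sum.inter_filter)

definition level :: "nat \<Rightarrow> code set" where
  "level m = {t. valid t \<and> length (fst t) = m}"

definition level_series :: "nat \<Rightarrow> rat fps" where
  "level_series m = (\<Sum>t\<in>level m. fps_X ^ weight t)"

text \<open>
  The offset \<open>k\<close> allows the induction in \<open>sum_run_weight\<close> to peel off the first letter; the series of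
  the theorem uses \<open>k = 0\<close>.
\<close>

definition odd_product :: "nat \<Rightarrow> nat \<Rightarrow> rat fps" where
  "odd_product k m = (\<Prod>i<m. 1 + fps_X ^ (2 * (k + i) + 1))"

text \<open>
  The exponent is \<open>0\<close> for \<open>i = 0\<close>, so this is \<open>1 + X + X^3 + ... + X^(2m - 1)\<close>.
\<close>

definition tail_series :: "nat \<Rightarrow> rat fps" where
  "tail_series m = (\<Sum>i\<le>m. fps_X ^ (2 * i - 1))"

definition lists_from :: "letter \<Rightarrow> nat \<Rightarrow> letter list set" where
  "lists_from c m = {p. length p = Suc m \<and> hd p = c}"

lemma UNIV_letter: "UNIV = {x0, x1}"
  using letter.exhaust by auto

instance letter :: finite
  by standard (simp add: UNIV_letter)

lemma finite_lists_from: "finite (lists_from c m)"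
  using finite_lists_length_eq[of "UNIV :: letter set" "Suc m"] by (auto simp: lists_from_def)

lemma lists_from_0: "lists_from c 0 = {[c]}"
  by (auto simp: lists_from_def length_Suc_conv)

lemma lists_from_Suc: "lists_from c (Suc m) = (#) c ` (lists_from c m \<union> lists_from (flip c) m)"
proof -
  have "d = c \<or> d = flip c" for d
    by (cases c; cases d) auto
  then show ?thesis
    by (auto simp: lists_from_def length_Suc_conv image_iff)
qed

text \<open>
  The letters of a list with a given head are determined by the set of its interior run ends, and each
  of the \<open>m\<close> interior positions can be chosen independently, contributing one factor of the product.
  The end of the list is always a run end.
\<close>

lemma sum_run_weight: "(\<Sum>p\<in>lists_from c m. fps_X ^ run_weight k p) = fps_X ^ (2 * (k + m) + 1) * odd_product k m"
proof (induction m arbitrary: k c)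
  case 0
  then show ?case by (simp add: lists_from_0 odd_product_def)
next
  case (Suc m)
  have ne: "p \<noteq> [] \<and> hd p = d" if "p \<in> lists_from d m" for p d
    using that by (auto simp: lists_from_def)
  have "(\<Sum>p\<in>lists_from c (Suc m). fps_X ^ run_weight k p :: rat fps) =
      (\<Sum>p\<in>lists_from c m \<union> lists_from (flip c) m. fps_X ^ run_weight k (c # p))"
    by (simp add: lists_from_Suc sum.reindex)
  also have "\<dots> = (\<Sum>p\<in>lists_from c m. fps_X ^ run_weight k (c # p)) + (\<Sum>p\<in>lists_from (flip c) m. fps_X ^ run_weight k (c # p))"
    by (rule sum.union_disjoint) (simp_all add: finite_lists_from, auto simp: lists_from_def)
  also have "(\<Sum>p\<in>lists_from c m. fps_X ^ run_weight k (c # p) :: rat fps) = (\<Sum>p\<in>lists_from c m. fps_X ^ run_weight (Suc k) p)"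
    by (rule sum.cong) (use ne in auto)
  also have "(\<Sum>p\<in>lists_from (flip c) m. fps_X ^ run_weight k (c # p) :: rat fps) =
      fps_X ^ (2 * k + 1) * (\<Sum>p\<in>lists_from (flip c) m. fps_X ^ run_weight (Suc k) p)"
    unfolding sum_distrib_left power_add[symmetric]
  proof (rule sum.cong)
    fix p assume "p \<in> lists_from (flip c) m"
    then have "run_weight k (c # p) = 2 * k + 1 + run_weight (Suc k) p"
      using ne by simp
    then show "fps_X ^ run_weight k (c # p) = (fps_X ^ (2 * k + 1 + run_weight (Suc k) p) :: rat fps)"
      by (simp only:)
  qed simp
  finally have "(\<Sum>p\<in>lists_from c (Suc m). fps_X ^ run_weight k p :: rat fps) =
      fps_X ^ (2 * (Suc k + m) + 1) * (odd_product (Suc k) m * (1 + fps_X ^ (2 * k + 1)))"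
    unfolding Suc.IH by (simp only: algebra_simps mult_1_left)
  also have "odd_product (Suc k) m * (1 + fps_X ^ (2 * k + 1)) = odd_product k (Suc m)"
    unfolding odd_product_def prod.lessThan_Suc_shift by (simp add: mult.commute)
  finally show ?case
    by simp
qed

lemma level_0: "level 0 = {([], 0, 0)}"
  by (auto simp: level_def)

lemma level_Suc:
  "level (Suc m) = (\<lambda>(p, i). (p, i, Suc m - i)) ` ((lists_from x0 m \<union> lists_from x1 m) \<times> {..Suc m})"
proof -
  have "p \<in> lists_from x0 m \<union> lists_from x1 m \<longleftrightarrow> length p = Suc m" for p
    using letter.exhaust[of "hd p"] by (auto simp: lists_from_def)
  then show ?thesis
    by (force simp: level_def image_iff)
qed

lemma finite_level: "finite (level m)"
  by (cases m) (simp_all add: level_0 level_Suc finite_lists_from)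

lemma tail_series_reverse: "(\<Sum>i\<le>m. fps_X ^ (2 * (m - i) - 1)) = tail_series m"
  unfolding tail_series_def by (rule sum.reindex_bij_witness[of _ "\<lambda>i. m - i" "\<lambda>i. m - i"]) auto

lemma level_series_0: "level_series 0 = 1"
  by (simp add: level_series_def level_0)

text \<open>
  The factor \<open>1 + X\<close> comes from the first letter. The weighed deletion count is \<open>i\<close> or
  \<open>Suc m - i\<close>, depending on the last letter of \<open>p\<close>, but it runs through the same values in both
  cases, which makes the sum over \<open>i\<close> independent of \<open>p\<close>.
\<close>

lemma level_series_Suc: "level_series (Suc m) = (1 + fps_X) * fps_X ^ (2 * m + 1) * odd_product 0 m * tail_series (Suc m)"
proof -
  let ?w = "\<lambda>p. (\<Sum>i\<le>Suc m. fps_X ^ weight (p, i, Suc m - i)) :: rat fps"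
  have w: "?w p = fps_X ^ (if c = x0 then 1 else 0) * fps_X ^ run_weight 0 p * tail_series (Suc m)"
    if "p \<in> lists_from c m" for p c
  proof -
    have "p \<noteq> []" "hd p = c"
      using that by (auto simp: lists_from_def)
    then have "weight (p, i, Suc m - i) =
        (if c = x0 then 1 else 0) + run_weight 0 p + (2 * (if last p = x0 then i else Suc m - i) - 1)" for i
      by simp
    then have "?w p = fps_X ^ (if c = x0 then 1 else 0) * fps_X ^ run_weight 0 p *
        (\<Sum>i\<le>Suc m. fps_X ^ (2 * (if last p = x0 then i else Suc m - i) - 1))"
      by (simp only: power_add sum_distrib_left)
    also have "(\<Sum>i\<le>Suc m. fps_X ^ (2 * (if last p = x0 then i else Suc m - i) - 1)) = tail_series (Suc m)"
      using tail_series_reverse[of "Suc m"] by (cases "last p = x0") (simp_all add: tail_series_def del: sum.atMost_Suc)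
    finally show ?thesis .
  qed
  have sum_w: "(\<Sum>p\<in>lists_from c m. ?w p) =
      fps_X ^ (if c = x0 then 1 else 0) * (fps_X ^ (2 * m + 1) * odd_product 0 m) * tail_series (Suc m)" for c
  proof -
    have "(\<Sum>p\<in>lists_from c m. ?w p) =
        (\<Sum>p\<in>lists_from c m. fps_X ^ (if c = x0 then 1 else 0) * fps_X ^ run_weight 0 p * tail_series (Suc m))"
      by (rule sum.cong[OF refl w])
    also have "\<dots> = fps_X ^ (if c = x0 then 1 else 0) * (\<Sum>p\<in>lists_from c m. fps_X ^ run_weight 0 p) * tail_series (Suc m)"
      by (simp only: sum_distrib_left sum_distrib_right)
    finally show ?thesis
      by (simp only: sum_run_weight add_0)
  qed
  have "inj_on (\<lambda>(p, i). (p, i, Suc m - i)) A" for A :: "(letter list \<times> nat) set"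
    by (auto simp: inj_on_def)
  then have "level_series (Suc m) = (\<Sum>p\<in>lists_from x0 m \<union> lists_from x1 m. ?w p)"
    unfolding level_series_def level_Suc by (simp only: sum.reindex sum.cartesian_product) (simp add: case_prod_beta)
  also have "\<dots> = (\<Sum>p\<in>lists_from x0 m. ?w p) + (\<Sum>p\<in>lists_from x1 m. ?w p)"
    by (rule sum.union_disjoint) (auto simp: finite_lists_from, auto simp: lists_from_def)
  finally show ?thesis
    unfolding sum_w by (simp add: algebra_simps)
qed

lemma sum_odd_powers:
  fixes x :: "'a :: comm_ring_1"
  shows "(1 - x ^ 2) * (\<Sum>i\<le>Suc m. x ^ (2 * i - 1)) = 1 + x - x ^ 2 - x ^ 2 * x ^ (2 * m + 1)"
proof (induction m)
  case 0
  then show ?case by (simp add: algebra_simps power2_eq_square)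
next
  case (Suc m)
  have "(1 - x ^ 2) * (\<Sum>i\<le>Suc (Suc m). x ^ (2 * i - 1)) =
      (1 - x ^ 2) * (\<Sum>i\<le>Suc m. x ^ (2 * i - 1)) + (1 - x ^ 2) * (x ^ 2 * x ^ (2 * m + 1))"
    by (simp add: distrib_left power2_eq_square mult.assoc)
  then show ?case
    unfolding Suc by (simp add: algebra_simps power2_eq_square)
qed

text \<open>
  The sum telescopes: by \<open>sum_odd_powers\<close>, the factor \<open>1 - X\<close> from the left and \<open>1 + X\<close> from
  \<open>level_series_Suc\<close> turn the tail series into a polynomial with four terms. The correction
  \<open>X^(2N + 1)\<close> vanishes in the limit and leaves \<open>X\<close> times the infinite product.
\<close>

lemma sum_level_series: "(1 - fps_X) * (\<Sum>m<N. level_series (Suc m)) = (fps_X - fps_X ^ (2 * N + 1)) * odd_product 0 N"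
proof (induction N)
  case 0
  then show ?case by (simp add: odd_product_def)
next
  case (Suc N)
  define x y p :: "rat fps" where "x = fps_X" and "y = fps_X ^ (2 * N + 1)" and "p = odd_product 0 N"
  have "(1 - x) * level_series (Suc N) = (1 - x) * ((1 + x) * y * p * tail_series (Suc N))"
    unfolding level_series_Suc x_def y_def p_def ..
  also have "\<dots> = ((1 - x ^ 2) * tail_series (Suc N)) * y * p"
    by (simp only: algebra_simps power2_eq_square mult_1_left)
  also have "(1 - x ^ 2) * tail_series (Suc N) = 1 + x - x ^ 2 - x ^ 2 * y"
    unfolding tail_series_def x_def y_def by (rule sum_odd_powers)
  finally have "(1 - x) * (\<Sum>m<Suc N. level_series (Suc m)) = (x - y) * p + (1 + x - x ^ 2 - x ^ 2 * y) * y * p"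
    using Suc by (simp only: sum.lessThan_Suc distrib_left x_def y_def p_def)
  also have "\<dots> = (x - x ^ 2 * y) * (p * (1 + y))"
    by (simp add: algebra_simps power2_eq_square)
  also have "p * (1 + y) = odd_product 0 (Suc N)"
    by (simp add: odd_product_def p_def y_def)
  also have "x ^ 2 * y = fps_X ^ (2 * Suc N + 1)"
    unfolding x_def y_def power_add[symmetric] by (rule arg_cong[of _ _ "power fps_X"]) simp
  finally show ?case
    unfolding x_def .
qed

section \<open>The growth series\<close>

definition weight_count :: "nat \<Rightarrow> nat" where
  "weight_count n = card {t. valid t \<and> weight t = n}"

lemma card_reachable_0: "card (reachable 0) = weight_count 0"
  by (simp add: reachable_eq weight_count_def)

lemma finite_weight: "finite {t. valid t \<and> weight t = n}"
  by (rule finite_subset[OF _ finite_reachable[of n]]) (auto simp: reachable_eq)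

lemma card_reachable_Suc: "card (reachable (Suc n)) = card (reachable n) + weight_count (Suc n)"
proof -
  have "reachable (Suc n) = reachable n \<union> {t. valid t \<and> weight t = Suc n}"
    by (auto simp: reachable_eq simp del: valid.simps weight.simps reachable.simps)
  moreover have "reachable n \<inter> {t. valid t \<and> weight t = Suc n} = {}"
    by (auto simp: reachable_eq)
  ultimately show ?thesis
    unfolding weight_count_def by (simp only: card_Un_disjoint finite_reachable finite_weight)
qed

lemma level_series_nth: "fps_nth (level_series m) n = of_nat (card {t \<in> level m. weight t = n})"
  unfolding level_series_def by (rule fps_sum_weight_nth[OF finite_level])

lemma weight_count_nth:
  assumes "n \<le> N"
  shows "of_nat (weight_count n) = fps_nth (1 + (\<Sum>m<N. level_series (Suc m))) n"
proof -
  have "1 + (\<Sum>m<N. level_series (Suc m)) = (\<Sum>m\<le>N. level_series m)"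
    by (simp only: level_series_0[symmetric] sum.atMost_shift)
  also have "fps_nth \<dots> n = (\<Sum>m\<le>N. of_nat (card {t \<in> level m. weight t = n}))"
    by (simp only: fps_sum_nth level_series_nth)
  also have "\<dots> = of_nat (card (\<Union>m\<le>N. {t \<in> level m. weight t = n}))"
    by (subst card_UN_disjoint) (auto simp: finite_level, auto simp: level_def)
  also have "(\<Union>m\<le>N. {t \<in> level m. weight t = n}) = {t. valid t \<and> weight t = n}"
  proof -
    have "length (fst t) \<le> N" if "weight t = n" for t
      using that length_le_weight[of t] assms by simp
    then show ?thesis
      unfolding level_def by blast
  qed
  finally show ?thesis
    by (simp add: weight_count_def)
qed

lemma odd_product_stable:
  assumes "k \<le> m"
  shows "fps_nth (odd_product 0 m) k = fps_nth (odd_product 0 k) k"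
  using assms
proof (induction m rule: dec_induct)
  case (step m)
  have "odd_product 0 (Suc m) = odd_product 0 m + odd_product 0 m * fps_X ^ (2 * m + 1)"
    by (simp only: odd_product_def prod.lessThan_Suc distrib_left mult_1_right add_0)
  then show ?case
    using step by (simp only: fps_add_nth fps_X_power_mult_right_nth) simp
qed simp

text \<open>
  The factors from index \<open>m\<close> on are congruent to 1 modulo \<open>X^(2m + 1)\<close>, so the coefficients up to
  \<open>m\<close> no longer change.
\<close>

lemma prodinf_odd_nth:
  assumes "k \<le> m"
  shows "fps_nth (\<Prod>n. 1 + fps_X ^ (2 * n + 1) :: rat fps) k = fps_nth (odd_product 0 m) k"
proof -
  let ?L = "Abs_fps (\<lambda>k. fps_nth (odd_product 0 k) k)"
  have "(\<lambda>n. odd_product 0 (Suc n)) \<longlonglongrightarrow> ?L"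
  proof (rule tendsto_fpsI)
    fix k
    show "\<forall>\<^sub>F n in sequentially. fps_nth (odd_product 0 (Suc n)) k = fps_nth ?L k"
      using eventually_ge_at_top[of k] by eventually_elim (simp only: fps_nth_Abs_fps, rule odd_product_stable, simp)
  qed
  moreover have "fps_nth ?L 0 = 1"
    by (simp add: odd_product_def)
  then have "?L \<noteq> 0"
    by (metis fps_zero_nth zero_neq_one)
  ultimately have "raw_has_prod (\<lambda>n. 1 + fps_X ^ (2 * n + 1)) 0 ?L"
    unfolding raw_has_prod_def odd_product_def lessThan_Suc_atMost add_0 add_0_right by (rule conjI)
  then have "?L = (\<Prod>n. 1 + fps_X ^ (2 * n + 1))"
    by (intro has_prod_unique) (simp only: has_prod_def simp_thms)
  then have "fps_nth (\<Prod>n. 1 + fps_X ^ (2 * n + 1) :: rat fps) k = fps_nth ?L k"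
    by (simp only:)
  then show ?thesis
    by (simp only: fps_nth_Abs_fps odd_product_stable[OF assms])
qed

lemma weight_count_series:
  "(1 - fps_X) * (Abs_fps (\<lambda>n. of_nat (weight_count n)) - 1) = fps_X * (\<Prod>n. 1 + fps_X ^ (2 * n + 1) :: rat fps)"
    (is "(1 - fps_X) * ?D = fps_X * ?P")
proof (rule fps_ext)
  fix n
  have nth: "fps_nth ?D k = fps_nth (\<Sum>m<n. level_series (Suc m)) k" if "k \<le> n" for k
    using weight_count_nth[OF that] by simp
  have "fps_nth ((1 - fps_X) * F) n = fps_nth F n - (if n = 0 then 0 else fps_nth F (n - 1))" for F :: "rat fps"
    by (simp add: left_diff_distrib)
  then have "fps_nth ((1 - fps_X) * ?D) n = fps_nth ((1 - fps_X) * (\<Sum>m<n. level_series (Suc m))) n"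
    by (simp only: nth order_refl diff_le_self)
  also have "\<dots> = fps_nth (fps_X * odd_product 0 n - fps_X ^ (2 * n + 1) * odd_product 0 n) n"
    unfolding sum_level_series by (simp only: left_diff_distrib)
  also have "\<dots> = fps_nth (fps_X * ?P) n"
    using prodinf_odd_nth[of "n - 1" n] by (simp add: fps_X_power_mult_nth del: power_Suc)
  finally show "fps_nth ((1 - fps_X) * ?D) n = fps_nth (fps_X * ?P) n" .
qed

theorem mainTheorem2:
  shows "(Abs_fps (\<lambda>n. of_nat (word_growth {f0, f1} n)) =
      (1 + fps_X) * (1 + fps_X / (1 - fps_X) * (\<Prod>n. 1 + fps_X ^ (2 * n + 1)) :: rat fps))
    \<and> (Abs_fps (\<lambda>n. of_nat (automaton_growth I2 n)) =
      1 / (1 - fps_X) * (1 + fps_X / (1 - fps_X) * (\<Prod>n. 1 + fps_X ^ (2 * n + 1)) :: rat fps))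
    \<and> (Abs_fps (\<lambda>n. of_nat (semigroup_growth {f0, f1} n)) =
      (1 + fps_X) / (1 - fps_X) * (1 + fps_X / (1 - fps_X) * (\<Prod>n. 1 + fps_X ^ (2 * n + 1)) :: rat fps))"
proof -
  define A S W e :: "rat fps"
    where "A = Abs_fps (\<lambda>n. of_nat (automaton_growth I2 n))"
      and "S = Abs_fps (\<lambda>n. of_nat (semigroup_growth {f0, f1} n))"
      and "W = Abs_fps (\<lambda>n. of_nat (word_growth {f0, f1} n))"
      and "e = Abs_fps (\<lambda>n. of_nat (weight_count n))"
  define p :: "rat fps" where "p = (\<Prod>n. 1 + fps_X ^ (2 * n + 1))"
  have unit: "fps_nth (1 - fps_X :: rat fps) 0 \<noteq> 0"
    by simp
  have div: "y / (1 - fps_X) = x" if "(1 - fps_X) * x = y" for x y :: "rat fps"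
    using that unit by (metis fps_nonzeroI nonzero_mult_div_cancel_left)
  have e: "e = 1 + fps_X / (1 - fps_X) * p"
  proof -
    have "fps_X * p / (1 - fps_X) = e - 1"
      using weight_count_series by (intro div) (simp only: e_def p_def)
    moreover have "fps_X * p / (1 - fps_X) = fps_X / (1 - fps_X) * p"
      by (simp add: fps_divide_unit)
    ultimately show ?thesis
      by (simp add: algebra_simps)
  qed
  have A: "(1 - fps_X) * A = e"
  proof (rule fps_ext)
    show "fps_nth ((1 - fps_X) * A) n = fps_nth e n" for n
      by (cases n) (simp_all add: left_diff_distrib A_def e_def automaton_growth_I2 card_reachable_0 card_reachable_Suc del: reachable.simps)
  qed
  have S: "S = (1 + fps_X) * A"
  proof (rule fps_ext)
    show "fps_nth S n = fps_nth ((1 + fps_X) * A) n" for n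
      by (cases n) (simp_all add: distrib_right A_def S_def automaton_growth_I2 semigroup_growth_0 semigroup_growth_Suc del: reachable.simps)
  qed
  have W: "W = (1 - fps_X) * S"
  proof (rule fps_ext)
    show "fps_nth W n = fps_nth ((1 - fps_X) * S) n" for n
      by (cases n) (simp_all add: left_diff_distrib W_def S_def word_growth_0 word_growth_Suc)
  qed
  have "A = 1 / (1 - fps_X) * e"
    using div[OF A] by (simp add: fps_divide_unit mult.commute)
  moreover from this have "S = (1 + fps_X) / (1 - fps_X) * e"
    unfolding S by (simp add: fps_divide_unit mult.assoc)
  moreover have "W = (1 + fps_X) * e"
    unfolding W S A[symmetric] by (simp only: mult.left_commute)
  ultimately show ?thesis
    unfolding A_def S_def W_def e p_def by (intro conjI)
qed

end
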